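(* Let $p>0$, let $n$ be a non-negative integer, and let $a,b,c,\nu\in\mathbb{C}$ with $\Re(c)>\Re(b)>0$. Then, for $|z|<1$, $$\frac{d^n}{dz^n}\left\{F_{p,\nu}(a,b;c;z)\right\} =\frac{(a)_n(b)_n}{(c)_n}\,F_{p,\nu}(a+n,b+n;c+n;z),$$ and, for all $z\in\mathbb{C}$, $$\frac{d^n}{dz^n}\left\{\Phi_{p,\nu}(b;c;z)\right\} =\frac{(b)_n}{(c)_n}\,\Phi_{p,\nu}(b+n;c+n;z).$$
   Context: $K_\mu(z)$ denotes the modified Bessel function of the second kind of order $\mu$; $B(x,y)$ (two arguments) is the classical Beta function; $(a)_n$ is the Pochhammer symbol $(a)_0=1$, $(a)_n=a(a+1)\cdots(a+n-1)$. For $p>0$ the extended Beta function is $$B_{\nu}(x,y;p):= \sqrt{\frac{2p}{\pi}}\int_{0}^{1} t^{x-\frac{3}{2}}(1-t)^{y-\frac{3}{2}}\, K_{\nu+\frac{1}{2}}\left(\frac{p}{t(1-t)}\right)dt .$$ For $\Re(c)>\Re(b)>0$ define $$F_{p,\nu}(a,b;c;z):=\sum_{k=0}^\infty(a)_k\,\frac{B_{\nu}(b+k,c-b;p)}{B(b,c-b)}\,\frac{z^k}{k!}\quad(|z|<1),$$ $$\Phi_{p,\nu}(b;c;z):=\sum_{k=0}^\infty \frac{B_{\nu}(b+k,c-b;p)}{B(b,c-b)}\,\frac{z^k}{k!}\quad(z\in\mathbb{C}).$$ *)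

theory Defs
  imports "HOL-Complex_Analysis.Complex_Analysis"
begin

definition Bessel_I :: "complex \<Rightarrow> complex \<Rightarrow> complex" where
  "Bessel_I \<mu> z = (\<Sum>k. rGamma (\<mu> + of_nat k + 1) * (z / 2) powr (\<mu> + 2 * of_nat k) / fact k)"

text \<open>
  At integer orders the quotient is of the form \<open>0/0\<close>, and as usual \<open>K\<^sub>\<mu>\<close> is then its limiting
  value with respect to the order. The powers are principal.
\<close>
definition Bessel_K :: "complex \<Rightarrow> complex \<Rightarrow> complex" where
  "Bessel_K \<mu> z =
     (let Q = (\<lambda>m. of_real (pi / 2) * (Bessel_I (- m) z - Bessel_I m z) / sin (m * of_real pi))
      in if \<mu> \<in> \<int> then Lim (at \<mu>) Q else Q \<mu>)"

definition ext_Beta :: "complex \<Rightarrow> complex \<Rightarrow> complex \<Rightarrow> real \<Rightarrow> complex" where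
  "ext_Beta \<nu> x y p =
     of_real (sqrt (2 * p / pi)) *
     (LINT t:{0<..<1}|lborel.
        of_real t powr (x - 3 / 2) * of_real (1 - t) powr (y - 3 / 2) *
        Bessel_K (\<nu> + 1 / 2) (of_real (p / (t * (1 - t)))))"

definition ext_hypergeom_F ::
  "real \<Rightarrow> complex \<Rightarrow> complex \<Rightarrow> complex \<Rightarrow> complex \<Rightarrow> complex \<Rightarrow> complex" where
  "ext_hypergeom_F p \<nu> a b c z =
     (\<Sum>k. pochhammer a k * (ext_Beta \<nu> (b + of_nat k) (c - b) p / Beta b (c - b)) * (z ^ k / fact k))"

definition ext_hypergeom_Phi ::
  "real \<Rightarrow> complex \<Rightarrow> complex \<Rightarrow> complex \<Rightarrow> complex \<Rightarrow> complex" where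
  "ext_hypergeom_Phi p \<nu> b c z =
     (\<Sum>k. (ext_Beta \<nu> (b + of_nat k) (c - b) p / Beta b (c - b)) * (z ^ k / fact k))"

end

theory Submission imports Defs begin

text \<open>
  Both series are power series whose coefficients are controlled by the moments
  \<open>B\<^sub>\<nu>(b + k, c - b; p)\<close>. These are moments of a function on \<open>(0, 1)\<close> and are therefore bounded
  in \<open>k\<close>, so termwise differentiation is legitimate; a single derivative shifts the parameters
  because \<open>(a)\<^sub>k\<^sub>+\<^sub>1 = a (a + 1)\<^sub>k\<close> and \<open>B(b + 1, c - b) = (b / c) B(b, c - b)\<close>.
\<close>

text \<open>
  No integrability is assumed: \<open>t ^ k * g t\<close> only gets smaller in norm as \<open>k\<close> grows, so the first
  integrable moment dominates all later ones, while non-integrable moments have the junk value 0.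
\<close>
lemma bounded_moments:
  fixes g :: "real \<Rightarrow> complex"
  shows "\<exists>C. \<forall>k. norm (LINT t:{0<..<1}|lborel. of_real t ^ k * g t) \<le> C"
proof -
  define f where "f = (\<lambda>k t. indicator {0<..<1} t *\<^sub>R (of_real t ^ k * g t))"
  have f_int: "(LINT t:{0<..<1}|lborel. of_real t ^ k * g t) = integral\<^sup>L lborel (f k)" for k
    by (simp add: f_def set_lebesgue_integral_def)
  have f_mono: "norm (f k t) \<le> norm (f j t)" if "j \<le> k" for j k t
  proof (cases "t \<in> {0<..<1}")
    case True
    then have "t ^ k \<le> t ^ j"
      using that by (intro power_decreasing) auto
    then show ?thesis
      using True by (simp add: f_def norm_mult norm_power mult_right_mono)
  qed (simp add: f_def)
  show ?thesis
  proof (cases "\<exists>k. integrable lborel (f k)")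
    case False
    then show ?thesis
      by (intro exI[of _ 0]) (simp add: f_int not_integrable_integral_eq)
  next
    case True
    define j where "j = (LEAST k. integrable lborel (f k))"
    have j: "integrable lborel (f j)"
      unfolding j_def using True by (rule LeastI_ex)
    have "norm (integral\<^sup>L lborel (f k)) \<le> (LINT t|lborel. norm (f j t))" for k
    proof (cases "integrable lborel (f k)")
      case True
      then have "j \<le> k"
        unfolding j_def by (rule Least_le)
      have "norm (integral\<^sup>L lborel (f k)) \<le> (LINT t|lborel. norm (f k t))"
        by (rule integral_norm_bound)
      also have "\<dots> \<le> (LINT t|lborel. norm (f j t))"
        using True j f_mono[OF \<open>j \<le> k\<close>] by (intro integral_mono) auto
      finally show ?thesis .
    qed (simp add: not_integrable_integral_eq)
    then show ?thesis
      by (auto simp: f_int)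
  qed
qed

text \<open>Raising the first argument by \<open>k\<close> multiplies the integrand by
  \<open>t ^ k\<close>, so these values are a fixed constant times the moments of a single function
  \<open>g\<close>.\<close>

lemma ext_Beta_bounded:
  "\<exists>C. \<forall>k. norm (ext_Beta \<nu> (b + of_nat k) y p) \<le> C"
proof -
  define g where "g = (\<lambda>t. of_real t powr (b - 3 / 2) * of_real (1 - t) powr (y - 3 / 2) *
    Bessel_K (\<nu> + 1 / 2) (of_real (p / (t * (1 - t)))))"
  have "ext_Beta \<nu> (b + of_nat k) y p =
      of_real (sqrt (2 * p / pi)) * (LINT t:{0<..<1}|lborel. of_real t ^ k * g t)" for k
  proof -
    have "of_real t powr (b + of_nat k - 3 / 2) = of_real t ^ k * of_real t powr (b - 3 / 2)"
      if "t \<in> {0<..<1}" for t :: real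
    proof -
      have "b + of_nat k - 3 / 2 = of_nat k + (b - 3 / 2)"
        by simp
      then show ?thesis
        using that by (simp only: powr_add) (simp add: powr_nat')
    qed
    then show ?thesis
      unfolding ext_Beta_def g_def
      by (intro arg_cong[where f = "\<lambda>x. _ * x"] set_lebesgue_integral_cong)
        (auto simp: mult.assoc)
  qed
  moreover obtain C where "\<And>k. norm (LINT t:{0<..<1}|lborel. of_real t ^ k * g t) \<le> C"
    using bounded_moments[of g] by blast
  ultimately have "norm (ext_Beta \<nu> (b + of_nat k) y p) \<le> norm (of_real (sqrt (2 * p / pi)) :: complex) * C" for k
    by (simp only: norm_mult) (intro mult_left_mono; simp)
  then show ?thesis
    by blast
qed

lemma summable_bounded_mult:
  fixes e s :: "nat \<Rightarrow> complex"
  assumes "\<And>k. norm (e k) \<le> C" and "summable (\<lambda>k. norm (s k))"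
  shows "summable (\<lambda>k. e k * s k)"
proof (rule summable_comparison_test)
  show "\<exists>N. \<forall>k\<ge>N. norm (e k * s k) \<le> C * norm (s k)"
    using assms(1) by (auto simp: norm_mult intro!: mult_right_mono)
  show "summable (\<lambda>k. C * norm (s k))"
    using assms(2) by (rule summable_mult)
qed

text \<open>Up to sign, \<open>pochhammer a k / fact k\<close> is the binomial coefficient of
  \<open>- a\<close>. This is the series of (1 - z)^(-a), with radius of convergence 1, or infinite
  if \<open>- a\<close> is a natural number.\<close>

lemma summable_norm_pochhammer_power:
  fixes a z :: complex
  assumes "norm z < 1"
  shows "summable (\<lambda>k. norm (pochhammer a k / fact k * z ^ k))"
proof -
  have "1 \<le> conv_radius (\<lambda>k. (- a) gchoose k)"
    by (simp add: conv_radius_gchoose)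
  then have "ereal (norm z) < conv_radius (\<lambda>k. (- a) gchoose k)"
    using assms by (metis ereal_less(3) less_le_trans)
  then have "summable (\<lambda>k. norm (((- a) gchoose k) * z ^ k))"
    by (rule abs_summable_in_conv_radius)
  then show ?thesis
    by (simp add: gbinomial_pochhammer norm_mult norm_divide norm_power)
qed

text \<open>Adding 1 to both \<open>b\<close> and \<open>c\<close> preserves \<open>c - b\<close>,
  so the two numerators agree; only the normalising Beta value changes, by the factor
  \<open>b / c\<close>.\<close>

lemma ext_Beta_quotient_shift:
  assumes "Re c > Re b" and "Re b > 0"
  shows "ext_Beta \<nu> (b + of_nat (Suc k)) (c - b) p / Beta b (c - b) =
    b / c * (ext_Beta \<nu> (b + 1 + of_nat k) (c + 1 - (b + 1)) p / Beta (b + 1) (c + 1 - (b + 1)))"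
proof -
  have "b \<noteq> 0" "c \<noteq> 0"
    using assms by auto
  have "b \<notin> \<int>\<^sub>\<le>\<^sub>0"
    using assms by (auto elim!: nonpos_Ints_cases)
  then have "c * Beta (b + 1) (c - b) = b * Beta b (c - b)"
    using Beta_plus1_left[of b "c - b"] by simp
  then have "Beta (b + 1) (c - b) = b / c * Beta b (c - b)"
    using \<open>c \<noteq> 0\<close> by (simp add: field_simps)
  then show ?thesis
    using \<open>b \<noteq> 0\<close> \<open>c \<noteq> 0\<close> by (simp add: add.assoc)
qed

lemma ext_hypergeom_F_has_field_derivative:
  assumes "Re c > Re b" and "Re b > 0" and "norm z < 1"
  shows "(ext_hypergeom_F p \<nu> a b c has_field_derivative
    a * b / c * ext_hypergeom_F p \<nu> (a + 1) (b + 1) (c + 1) z) (at z)"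
proof -
  \<comment> \<open>The parameters are arguments of \<open>q\<close> and \<open>u\<close>, so that
    the coefficients of the shifted series are again values of \<open>u\<close>.\<close>
  define q where "q = (\<lambda>b c k. ext_Beta \<nu> (b + of_nat k) (c - b) p / Beta b (c - b))"
  define u where "u = (\<lambda>a b c k. pochhammer a k * q b c k / fact k)"
  have F: "ext_hypergeom_F p \<nu> a b c z = (\<Sum>k. u a b c k * z ^ k)" for a b c z
    by (simp add: ext_hypergeom_F_def u_def q_def)
  \<comment> \<open>Needed on the whole disc for termwise differentiation, and at the shifted
    parameters to pull the constant out of the differentiated series.\<close>
  have summable: "summable (\<lambda>k. u a b c k * z ^ k)" if "norm z < 1" for a b c z
  proof -
    obtain C where C: "\<And>k. norm (ext_Beta \<nu> (b + of_nat k) (c - b) p) \<le> C"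
      using ext_Beta_bounded by blast
    have "norm (q b c k) \<le> C / norm (Beta b (c - b))" for k
      unfolding q_def norm_divide using C by (intro divide_right_mono) auto
    from summable_bounded_mult[OF this summable_norm_pochhammer_power[OF that]]
    show ?thesis
      by (simp add: u_def mult_ac)
  qed
  have "diffs (u a b c) k = a * b / c * u (a + 1) (b + 1) (c + 1) k" for k
  proof -
    have "q b c (Suc k) = b / c * q (b + 1) (c + 1) k"
      unfolding q_def by (rule ext_Beta_quotient_shift[OF assms(1,2)])
    \<comment> \<open>\<open>diffs\<close> contributes a factor \<open>Suc k\<close>, which cancels
      against \<open>fact (Suc k)\<close> when kept as one nonzero term.\<close>
    moreover have "of_nat (Suc k) \<noteq> (0 :: complex)"
      by (simp del: of_nat_Suc)
    ultimately show ?thesis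
      by (simp add: diffs_def u_def pochhammer_rec del: of_nat_Suc)
  qed
  then have "(\<Sum>k. diffs (u a b c) k * z ^ k) =
      a * b / c * ext_hypergeom_F p \<nu> (a + 1) (b + 1) (c + 1) z"
    using suminf_mult[OF summable[OF assms(3)], of "a * b / c" "a + 1" "b + 1" "c + 1"]
    by (simp add: F mult.assoc)
  moreover have "((\<lambda>z. \<Sum>k. u a b c k * z ^ k) has_field_derivative
      (\<Sum>k. diffs (u a b c) k * z ^ k)) (at z)"
    using summable assms(3) by (rule termdiffs_strong')
  ultimately show ?thesis
    by (simp add: F[abs_def])
qed

text \<open>Without the Pochhammer factor the exponential series serves as majorant, so the power
  series converges everywhere and \<open>z\<close> is unrestricted.\<close>

lemma ext_hypergeom_Phi_has_field_derivative:
  assumes "Re c > Re b" and "Re b > 0"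
  shows "(ext_hypergeom_Phi p \<nu> b c has_field_derivative
    b / c * ext_hypergeom_Phi p \<nu> (b + 1) (c + 1) z) (at z)"
proof -
  define q where "q = (\<lambda>b c k. ext_Beta \<nu> (b + of_nat k) (c - b) p / Beta b (c - b))"
  define u where "u = (\<lambda>b c k. q b c k / fact k)"
  have Phi: "ext_hypergeom_Phi p \<nu> b c z = (\<Sum>k. u b c k * z ^ k)" for b c z
    by (simp add: ext_hypergeom_Phi_def u_def q_def)
  have summable: "summable (\<lambda>k. u b c k * z ^ k)" for b c z
  proof -
    obtain C where C: "\<And>k. norm (ext_Beta \<nu> (b + of_nat k) (c - b) p) \<le> C"
      using ext_Beta_bounded by blast
    have "norm (q b c k) \<le> C / norm (Beta b (c - b))" for k
      unfolding q_def norm_divide using C by (intro divide_right_mono) auto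
    from summable_bounded_mult[OF this summable_norm_exp[of z]]
    show ?thesis
      by (simp add: u_def scaleR_conv_of_real divide_simps)
  qed
  have "diffs (u b c) k = b / c * u (b + 1) (c + 1) k" for k
  proof -
    have "q b c (Suc k) = b / c * q (b + 1) (c + 1) k"
      unfolding q_def by (rule ext_Beta_quotient_shift[OF assms])
    moreover have "of_nat (Suc k) \<noteq> (0 :: complex)"
      by (simp del: of_nat_Suc)
    ultimately show ?thesis
      by (simp add: diffs_def u_def del: of_nat_Suc)
  qed
  then have "(\<Sum>k. diffs (u b c) k * z ^ k) =
      b / c * ext_hypergeom_Phi p \<nu> (b + 1) (c + 1) z"
    using suminf_mult[OF summable, of "b / c" "b + 1" "c + 1" z]
    by (simp add: Phi mult.assoc)
  moreover have "((\<lambda>z. \<Sum>k. u b c k * z ^ k) has_field_derivative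
      (\<Sum>k. diffs (u b c) k * z ^ k)) (at z)"
    using summable by (rule termdiffs_strong_converges_everywhere)
  ultimately show ?thesis
    by (simp add: Phi[abs_def])
qed

text \<open>The induction step applies the one-derivative rule at parameters already shifted by
  \<open>n\<close>; the shift preserves the conditions on the real parts.\<close>

lemma higher_deriv_ext_hypergeom_F:
  assumes "Re c > Re b" and "Re b > 0" and "norm z < 1"
  shows "(deriv ^^ n) (ext_hypergeom_F p \<nu> a b c) z =
    pochhammer a n * pochhammer b n / pochhammer c n *
    ext_hypergeom_F p \<nu> (a + of_nat n) (b + of_nat n) (c + of_nat n) z"
  using assms(3)
proof (induction n arbitrary: z)
  case (Suc n)
  let ?r = "pochhammer a n * pochhammer b n / pochhammer c n"
  let ?F = "ext_hypergeom_F p \<nu> (a + of_nat n) (b + of_nat n) (c + of_nat n)"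
  have "(?F has_field_derivative (a + of_nat n) * (b + of_nat n) / (c + of_nat n) *
      ext_hypergeom_F p \<nu> (a + of_nat n + 1) (b + of_nat n + 1) (c + of_nat n + 1) z) (at z)"
    using assms(1,2) Suc.prems by (intro ext_hypergeom_F_has_field_derivative) auto
  then have "((\<lambda>w. ?r * ?F w) has_field_derivative ?r * ((a + of_nat n) * (b + of_nat n) / (c + of_nat n) *
      ext_hypergeom_F p \<nu> (a + of_nat n + 1) (b + of_nat n + 1) (c + of_nat n + 1) z)) (at z)"
    by (rule DERIV_cmult)
  \<comment> \<open>The induction hypothesis holds only inside the open unit disc; agreement near
    \<open>z\<close> suffices to replace the function under \<open>deriv\<close>.\<close>
  moreover have "eventually (\<lambda>w. (deriv ^^ n) (ext_hypergeom_F p \<nu> a b c) w = ?r * ?F w) (nhds z)"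
  proof (rule eventually_mono)
    show "eventually (\<lambda>w. w \<in> ball 0 1) (nhds z)"
      using Suc.prems by (intro eventually_nhds_in_open) auto
  qed (simp add: Suc.IH)
  \<comment> \<open>The new factors \<open>a + n\<close>, \<open>b + n\<close> and
    \<open>c + n\<close> are the last ones of the Pochhammer symbols of length
    \<open>Suc n\<close>.\<close>
  ultimately show ?case
    by (simp add: deriv_cong_ev DERIV_imp_deriv pochhammer_Suc add_ac)
qed simp

lemma higher_deriv_ext_hypergeom_Phi:
  assumes "Re c > Re b" and "Re b > 0"
  shows "(deriv ^^ n) (ext_hypergeom_Phi p \<nu> b c) z =
    pochhammer b n / pochhammer c n * ext_hypergeom_Phi p \<nu> (b + of_nat n) (c + of_nat n) z"
proof (induction n arbitrary: z)
  case (Suc n)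
  let ?r = "pochhammer b n / pochhammer c n"
  let ?Phi = "ext_hypergeom_Phi p \<nu> (b + of_nat n) (c + of_nat n)"
  have "(?Phi has_field_derivative (b + of_nat n) / (c + of_nat n) *
      ext_hypergeom_Phi p \<nu> (b + of_nat n + 1) (c + of_nat n + 1) z) (at z)"
    using assms by (intro ext_hypergeom_Phi_has_field_derivative) auto
  then have "((\<lambda>w. ?r * ?Phi w) has_field_derivative ?r * ((b + of_nat n) / (c + of_nat n) *
      ext_hypergeom_Phi p \<nu> (b + of_nat n + 1) (c + of_nat n + 1) z)) (at z)"
    by (rule DERIV_cmult)
  \<comment> \<open>Here the induction hypothesis holds at every point, so it is an equality of
    functions.\<close>
  moreover have "(deriv ^^ n) (ext_hypergeom_Phi p \<nu> b c) = (\<lambda>w. ?r * ?Phi w)"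
    using Suc.IH by blast
  ultimately show ?case
    by (simp add: DERIV_imp_deriv pochhammer_Suc add_ac)
qed simp

theorem theorem7:
  fixes p :: real and n :: nat and a b c \<nu> :: complex
  assumes "p > 0" and "Re c > Re b" and "Re b > 0"
  shows "(\<forall>z::complex. norm z < 1 \<longrightarrow>
            (deriv ^^ n) (ext_hypergeom_F p \<nu> a b c) z =
              pochhammer a n * pochhammer b n / pochhammer c n *
              ext_hypergeom_F p \<nu> (a + of_nat n) (b + of_nat n) (c + of_nat n) z) \<and>
         (\<forall>z::complex.
            (deriv ^^ n) (ext_hypergeom_Phi p \<nu> b c) z =
              pochhammer b n / pochhammer c n *
              ext_hypergeom_Phi p \<nu> (b + of_nat n) (c + of_nat n) z)"
  using assms higher_deriv_ext_hypergeom_F higher_deriv_ext_hypergeom_Phi by blast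

end
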